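(* Let $X$ be a topological space endowed with an admissible family $\mathcal{O}$ of open coverings of $X$. Then $X$ is complete (every $\mathcal{O}$-Cauchy net in $X$ converges) if and only if every decreasing net $(F_\lambda)$ of nonempty bounded closed subsets of $X$ with $\gamma(F_\lambda)\rightarrow\mathcal{O}$ has nonempty compact intersection $\bigcap_\lambda F_\lambda$.
   Context: Compactness does not include the Hausdorff property, and $X$ is not assumed Hausdorff. Coverings. For coverings $\mathcal{U},\mathcal{V}$ of $X$, $\mathcal{V}\leqslant\mathcal{U}$ means that $\mathcal{V}$ is a refinement of $\mathcal{U}$; $\mathcal{V}\leqslant\frac12\mathcal{U}$ means that for all $V,V'\in\mathcal{V}$ with $V\cap V'\neq\emptyset$ there is $U\in\mathcal{U}$ with $V\cup V'\subset U$. For $Y\subset X$, $\mathrm{St}[Y,\mathcal{U}]=\bigcup\{U\in\mathcal{U}:Y\cap U\neq\emptyset\}$, and $\mathrm{St}[x,\mathcal{U}]=\mathrm{St}[\{x\},\mathcal{U}]$. Admissible family. A family $\mathcal{O}$ of open coverings of $X$ is admissible if: (1) for each $\mathcal{U}\in\mathcal{O}$ there is $\mathcal{V}\in\mathcal{O}$ with $\mathcal{V}\leqslant\frac12\mathcal{U}$; (2) if $Y\subset X$ is open and $K\subset Y$ is compact, there is $\mathcal{U}\in\mathcal{O}$ with $\mathrm{St}[K,\mathcal{U}]\subset Y$; (3) for any $\mathcal{U},\mathcal{V}\in\mathcal{O}$ there is $\mathcal{W}\in\mathcal{O}$ with $\mathcal{W}\leqslant\mathcal{U}$ and $\mathcal{W}\leqslant\mathcal{V}$.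 Notation. For $x,y\in X$, $\rho(x,y)=\{\mathcal{U}\in\mathcal{O}: y\in\mathrm{St}[x,\mathcal{U}]\}$. A net $(\mathcal{E}_\lambda)$ of subsets of $\mathcal{O}$ converges to $\mathcal{O}$, written $\mathcal{E}_\lambda\rightarrow\mathcal{O}$, if for every $\mathcal{U}\in\mathcal{O}$ there is $\lambda_0$ such that $\mathcal{U}\in\mathcal{E}_\lambda$ whenever $\lambda\ge\lambda_0$. A nonempty $Y\subset X$ is bounded if there is $\mathcal{U}\in\mathcal{O}$ with $\mathcal{U}\in\rho(x,y)$ for all $x,y\in Y$. The diameter of a nonempty $Y\subset X$ is $\mathrm{D}(Y)=\bigcap_{x,y\in Y}\rho(x,y)\subset\mathcal{O}$. The diameter measure of noncompactness of a nonempty $Y\subset X$ is $\gamma(Y)=\{\mathcal{U}\in\mathcal{O}: Y \text{ admits a finite cover } Y\subset\bigcup_{i=1}^n X_i \text{ with } \mathcal{U}\in\mathrm{D}(X_i) \text{ for each } i\}$, where the $X_i$ are nonempty subsets of $X$. A net $(x_\lambda)$ in $X$ is ($\mathcal{O}$-)Cauchy if for each $\mathcal{U}\in\mathcal{O}$ there is $\lambda_0$ such that $x_{\lambda_1}\in\mathrm{St}[x_{\lambda_2},\mathcal{U}]$ whenever $\lambda_1,\lambda_2\ge\lambda_0$. A decreasing net $(F_\lambda)$ of sets is a family indexed by a directed set with $F_{\lambda_1}\subset F_{\lambda_2}$ whenever $\lambda_1\ge\lambda_2$. *)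

theory Defs
  imports "HOL-Analysis.Abstract_Topology"
begin

section \<open>Coverings and admissible families\<close>

definition open_covering :: "'a topology \<Rightarrow> 'a set set \<Rightarrow> bool" where
  "open_covering X U \<longleftrightarrow> (\<forall>A\<in>U. openin X A) \<and> \<Union>U = topspace X"

definition refines :: "'a set set \<Rightarrow> 'a set set \<Rightarrow> bool" where
  "refines V U \<longleftrightarrow> (\<forall>A\<in>V. \<exists>B\<in>U. A \<subseteq> B)"

definition half_refines :: "'a set set \<Rightarrow> 'a set set \<Rightarrow> bool" where
  "half_refines V U \<longleftrightarrow> (\<forall>A\<in>V. \<forall>A'\<in>V. A \<inter> A' \<noteq> {} \<longrightarrow> (\<exists>B\<in>U. A \<union> A' \<subseteq> B))"

definition star :: "'a set \<Rightarrow> 'a set set \<Rightarrow> 'a set" where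
  "star Y U = \<Union>{A \<in> U. Y \<inter> A \<noteq> {}}"

definition admissible_family :: "'a topology \<Rightarrow> 'a set set set \<Rightarrow> bool" where
  "admissible_family X \<O> \<longleftrightarrow>
     (\<forall>U\<in>\<O>. open_covering X U) \<and>
     (\<forall>U\<in>\<O>. \<exists>V\<in>\<O>. half_refines V U) \<and>
     (\<forall>Y K. openin X Y \<and> K \<subseteq> Y \<and> compactin X K \<longrightarrow> (\<exists>U\<in>\<O>. star K U \<subseteq> Y)) \<and>
     (\<forall>U\<in>\<O>. \<forall>V\<in>\<O>. \<exists>W\<in>\<O>. refines W U \<and> refines W V)"


section \<open>Boundedness, diameter, measure of noncompactness\<close>

definition rho :: "'a set set set \<Rightarrow> 'a \<Rightarrow> 'a \<Rightarrow> 'a set set set" where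
  "rho \<O> x y = {U \<in> \<O>. y \<in> star {x} U}"

definition cov_bounded :: "'a topology \<Rightarrow> 'a set set set \<Rightarrow> 'a set \<Rightarrow> bool" where
  "cov_bounded X \<O> Y \<longleftrightarrow>
     Y \<noteq> {} \<and> Y \<subseteq> topspace X \<and> (\<exists>U\<in>\<O>. \<forall>x\<in>Y. \<forall>y\<in>Y. U \<in> rho \<O> x y)"

text \<open>Only meaningful for nonempty \<open>Y\<close>.\<close>
definition cov_diam :: "'a set set set \<Rightarrow> 'a set \<Rightarrow> 'a set set set" where
  "cov_diam \<O> Y = (\<Inter>x\<in>Y. \<Inter>y\<in>Y. rho \<O> x y)"

definition cov_gamma :: "'a topology \<Rightarrow> 'a set set set \<Rightarrow> 'a set \<Rightarrow> 'a set set set" where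
  "cov_gamma X \<O> Y =
     {U \<in> \<O>. \<exists>\<C>. finite \<C> \<and> Y \<subseteq> \<Union>\<C> \<and>
        (\<forall>A\<in>\<C>. A \<noteq> {} \<and> A \<subseteq> topspace X \<and> U \<in> cov_diam \<O> A)}"


section \<open>Nets\<close>

definition directed_set :: "'i set \<Rightarrow> ('i \<Rightarrow> 'i \<Rightarrow> bool) \<Rightarrow> bool" where
  "directed_set I le \<longleftrightarrow>
     I \<noteq> {} \<and> reflp_on I le \<and> transp_on I le \<and>
     (\<forall>i\<in>I. \<forall>j\<in>I. \<exists>k\<in>I. le i k \<and> le j k)"

definition net_converges ::
  "'a topology \<Rightarrow> 'i set \<Rightarrow> ('i \<Rightarrow> 'i \<Rightarrow> bool) \<Rightarrow> ('i \<Rightarrow> 'a) \<Rightarrow> 'a \<Rightarrow> bool" where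
  "net_converges X I le x l \<longleftrightarrow> l \<in> topspace X \<and>
     (\<forall>W. openin X W \<and> l \<in> W \<longrightarrow> (\<exists>i\<^sub>0\<in>I. \<forall>i\<in>I. le i\<^sub>0 i \<longrightarrow> x i \<in> W))"

definition cauchy_net ::
  "'a set set set \<Rightarrow> 'i set \<Rightarrow> ('i \<Rightarrow> 'i \<Rightarrow> bool) \<Rightarrow> ('i \<Rightarrow> 'a) \<Rightarrow> bool" where
  "cauchy_net \<O> I le x \<longleftrightarrow>
     (\<forall>U\<in>\<O>. \<exists>i\<^sub>0\<in>I. \<forall>i\<in>I. \<forall>j\<in>I. le i\<^sub>0 i \<and> le i\<^sub>0 j \<longrightarrow> x i \<in> star {x j} U)"

definition converges_to_family ::
  "'a set set set \<Rightarrow> 'i set \<Rightarrow> ('i \<Rightarrow> 'i \<Rightarrow> bool) \<Rightarrow> ('i \<Rightarrow> 'a set set set) \<Rightarrow> bool" where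
  "converges_to_family \<O> I le E \<longleftrightarrow>
     (\<forall>U\<in>\<O>. \<exists>i\<^sub>0\<in>I. \<forall>i\<in>I. le i\<^sub>0 i \<longrightarrow> U \<in> E i)"

definition decreasing_net ::
  "'i set \<Rightarrow> ('i \<Rightarrow> 'i \<Rightarrow> bool) \<Rightarrow> ('i \<Rightarrow> 'a set) \<Rightarrow> bool" where
  "decreasing_net I le F \<longleftrightarrow> (\<forall>i\<in>I. \<forall>j\<in>I. le i j \<longrightarrow> F j \<subseteq> F i)"

text \<open>
  HOL cannot quantify over index types inside a formula.  A statement about all nets is
  therefore phrased for all directed subsets, under arbitrary directed preorders, of one index
  type that is large enough; the lemmas \<open>cov_complete_any_index\<close> and
  \<open>decreasing_nets_any_index\<close> show that such statements then hold for nets over every index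
  type.
\<close>
type_synonym 'a net_index = "'a set \<times> 'a"

definition cov_complete :: "'a topology \<Rightarrow> 'a set set set \<Rightarrow> bool" where
  "cov_complete X \<O> \<longleftrightarrow>
     (\<forall>(I :: 'a net_index set) le x.
        directed_set I le \<and> x \<in> I \<rightarrow> topspace X \<and> cauchy_net \<O> I le x
        \<longrightarrow> (\<exists>l. net_converges X I le x l))"

lemma cov_complete_any_index:
  fixes I :: "'i set" and x :: "'i \<Rightarrow> 'a"
  assumes "cov_complete X \<O>"
    and dir: "directed_set I le" and x: "x \<in> I \<rightarrow> topspace X" and cau: "cauchy_net \<O> I le x"
  shows "\<exists>l. net_converges X I le x l"
proof -
  define T where "T i = x ` {j \<in> I. le i j}" for i
  define J :: "'a net_index set" where "J = {(A, a). a \<in> A \<and> (\<exists>i\<in>I. A = T i)}"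
  define le' :: "'a net_index \<Rightarrow> 'a net_index \<Rightarrow> bool" where "le' p q \<longleftrightarrow> fst q \<subseteq> fst p" for p q
  have refl: "le i i" if "i \<in> I" for i
    using dir that by (auto simp: directed_set_def reflp_on_def)
  have trans: "le i k" if "le i j" "le j k" "i \<in> I" "j \<in> I" "k \<in> I" for i j k
    using dir that transp_onD[of I le i j k] by (simp add: directed_set_def)
  have ub: "\<exists>k\<in>I. le i k \<and> le j k" if "i \<in> I" "j \<in> I" for i j
    using dir that by (auto simp: directed_set_def)
  have mem: "(T i, x j) \<in> J" if "i \<in> I" "j \<in> I" "le i j" for i j
    using that by (auto simp: J_def T_def)
  have "directed_set J le'"
    unfolding directed_set_def
  proof (intro conjI ballI)
    obtain i where "i \<in> I" using dir by (auto simp: directed_set_def)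
    then show "J \<noteq> {}" using mem[of i i] refl by blast
    show "reflp_on J le'" by (auto simp: reflp_on_def le'_def)
    show "transp_on J le'" by (auto simp: transp_on_def le'_def)
    fix p q assume "p \<in> J" "q \<in> J"
    then obtain i j where ij: "i \<in> I" "j \<in> I" "fst p = T i" "fst q = T j"
      by (auto simp: J_def)
    then obtain k where k: "k \<in> I" "le i k" "le j k" using ub by blast
    have "T k \<subseteq> T i" "T k \<subseteq> T j"
      using trans[OF k(2) _ ij(1) k(1)] trans[OF k(3) _ ij(2) k(1)] by (auto simp: T_def)
    then show "\<exists>r\<in>J. le' p r \<and> le' q r"
      using mem[of k k] refl k ij by (intro bexI[of _ "(T k, x k)"]) (auto simp: le'_def)
  qed
  moreover have "snd \<in> J \<rightarrow> topspace X"
    using x by (auto simp: J_def T_def)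
  moreover have "cauchy_net \<O> J le' snd"
    unfolding cauchy_net_def
  proof
    fix U assume "U \<in> \<O>"
    then obtain i where i: "i \<in> I"
      "\<And>j k. j \<in> I \<Longrightarrow> k \<in> I \<Longrightarrow> le i j \<Longrightarrow> le i k \<Longrightarrow> x j \<in> star {x k} U"
      using cau unfolding cauchy_net_def by blast
    have *: "a \<in> star {b} U" if "a \<in> T i" "b \<in> T i" for a b
      using that i by (auto simp: T_def)
    have "snd p \<in> star {snd q} U" if "p \<in> J" "q \<in> J" "fst p \<subseteq> T i" "fst q \<subseteq> T i" for p q
      using that by (intro *) (auto simp: J_def)
    then show "\<exists>i\<^sub>0\<in>J. \<forall>p\<in>J. \<forall>q\<in>J. le' i\<^sub>0 p \<and> le' i\<^sub>0 q \<longrightarrow> snd p \<in> star {snd q} U"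
      using mem[of i i] refl i by (intro bexI[of _ "(T i, x i)"]) (auto simp: le'_def)
  qed
  ultimately obtain l where l: "net_converges X J le' snd l"
    using assms(1) unfolding cov_complete_def by blast
  have "net_converges X I le x l"
    unfolding net_converges_def
  proof (intro conjI allI impI)
    show "l \<in> topspace X" using l by (simp add: net_converges_def)
    fix W assume "openin X W \<and> l \<in> W"
    then obtain p where p: "p \<in> J" "\<And>q. q \<in> J \<Longrightarrow> le' p q \<Longrightarrow> snd q \<in> W"
      using l unfolding net_converges_def by blast
    then obtain i where i: "i \<in> I" "fst p = T i" by (auto simp: J_def)
    have "x j \<in> W" if "j \<in> I" "le i j" for j
      using p(2)[OF mem[OF i(1) that]] i by (simp add: le'_def)
    then show "\<exists>i\<^sub>0\<in>I. \<forall>i\<in>I. le i\<^sub>0 i \<longrightarrow> x i \<in> W" using i by blast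
  qed
  then show ?thesis by blast
qed

lemma cov_gamma_antimono: "A \<subseteq> B \<Longrightarrow> cov_gamma X \<O> B \<subseteq> cov_gamma X \<O> A"
  unfolding cov_gamma_def by blast

lemma decreasing_nets_any_index:
  fixes J :: "'i set" and G :: "'i \<Rightarrow> 'a set"
  assumes canonical:
    "\<forall>(I :: 'a net_index set) le F.
       directed_set I le \<and> decreasing_net I le F \<and>
       (\<forall>i\<in>I. F i \<noteq> {} \<and> cov_bounded X \<O> (F i) \<and> closedin X (F i)) \<and>
       converges_to_family \<O> I le (\<lambda>i. cov_gamma X \<O> (F i))
       \<longrightarrow> (\<Inter>i\<in>I. F i) \<noteq> {} \<and> compactin X (\<Inter>i\<in>I. F i)"
    and dir: "directed_set J le" and dec: "decreasing_net J le G"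
    and G: "\<forall>i\<in>J. G i \<noteq> {} \<and> cov_bounded X \<O> (G i) \<and> closedin X (G i)"
    and conv: "converges_to_family \<O> J le (\<lambda>i. cov_gamma X \<O> (G i))"
  shows "(\<Inter>i\<in>J. G i) \<noteq> {} \<and> compactin X (\<Inter>i\<in>J. G i)"
proof -
  define I :: "'a net_index set" where "I = (\<lambda>i. (G i, undefined)) ` J"
  define le' :: "'a net_index \<Rightarrow> 'a net_index \<Rightarrow> bool" where "le' p q \<longleftrightarrow> fst q \<subseteq> fst p" for p q
  have "directed_set I le'"
    unfolding directed_set_def
  proof (intro conjI ballI)
    show "I \<noteq> {}" using dir by (auto simp: directed_set_def I_def)
    show "reflp_on I le'" by (auto simp: reflp_on_def le'_def)
    show "transp_on I le'" by (auto simp: transp_on_def le'_def)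
    fix p q assume "p \<in> I" "q \<in> I"
    then obtain i j where ij: "i \<in> J" "j \<in> J" "fst p = G i" "fst q = G j"
      by (auto simp: I_def)
    then obtain k where "k \<in> J" "le i k" "le j k"
      using dir unfolding directed_set_def by blast
    then show "\<exists>r\<in>I. le' p r \<and> le' q r"
      using dec ij by (intro bexI[of _ "(G k, undefined)"])
        (auto simp: le'_def I_def decreasing_net_def)
  qed
  moreover have "decreasing_net I le' fst"
    by (auto simp: decreasing_net_def le'_def)
  moreover have "\<forall>p\<in>I. fst p \<noteq> {} \<and> cov_bounded X \<O> (fst p) \<and> closedin X (fst p)"
    using G by (auto simp: I_def)
  moreover have "converges_to_family \<O> I le' (\<lambda>p. cov_gamma X \<O> (fst p))"
    unfolding converges_to_family_def
  proof
    fix U assume "U \<in> \<O>"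
    then obtain i where i: "i \<in> J" "\<forall>j\<in>J. le i j \<longrightarrow> U \<in> cov_gamma X \<O> (G j)"
      using conv by (auto simp: converges_to_family_def)
    moreover have "le i i"
      using dir i(1) by (simp add: directed_set_def reflp_on_def)
    ultimately have "U \<in> cov_gamma X \<O> (G i)" by blast
    then have "\<forall>p\<in>I. le' (G i, undefined) p \<longrightarrow> U \<in> cov_gamma X \<O> (fst p)"
      using cov_gamma_antimono[of _ "G i" X \<O>] by (auto simp: le'_def)
    then show "\<exists>i\<^sub>0\<in>I. \<forall>p\<in>I. le' i\<^sub>0 p \<longrightarrow> U \<in> cov_gamma X \<O> (fst p)"
      using i(1) by (auto simp: I_def)
  qed
  ultimately have "(\<Inter>p\<in>I. fst p) \<noteq> {} \<and> compactin X (\<Inter>p\<in>I. fst p)"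
    using canonical[rule_format, of I le' fst] by blast
  moreover have "(\<Inter>p\<in>I. fst p) = (\<Inter>i\<in>J. G i)" by (simp add: I_def)
  ultimately show ?thesis by simp
qed

end

theory Submission imports Defs begin

text \<open>
  The relations \<open>y \<in> star {x} U\<close>, one for each \<open>U\<close> in an admissible family, behave like a base of
  symmetric entourages of a uniform structure: half-refinement is the composition law, and the
  separation condition for one-point compact sets says that the stars are neighbourhood bases.
  The theorem is then the uniform version of the Cantor--Kuratowski intersection theorem.

  If \<open>X\<close> is complete, the two claims about \<open>K = (\<Inter>i\<in>I. F i)\<close> are one claim. By the finite
  intersection characterisation of compactness, both say that a family of closed sets with the
  finite intersection property has a common point, where the family contains all \<open>F i\<close>. Such a
  family extends to a maximal one (\<open>fip_extends_to_prime\<close>), in effect an ultrafilter. Since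
  \<open>\<gamma> (F i) \<rightarrow> \<O>\<close>, for every \<open>U\<close> some \<open>F i\<close> is a finite union of \<open>U\<close>-small sets, and one of these
  belongs to the ultrafilter. So the ultrafilter is Cauchy, the net of its pointed members
  converges by completeness, and the limit lies in every closed member (\<open>complete_fip\<close>).

  Conversely, the closures of the tails of a Cauchy net are closed and eventually as small as
  desired, because the closure of a small set is small (\<open>closure_of_small\<close>); in particular they are
  eventually bounded. Their intersection is therefore nonempty, and a point of it is a cluster
  point, hence a limit, of the net (\<open>cauchy_net_converges_to_cluster_point\<close>).
\<close>

section \<open>Stars as entourages\<close>

definition small :: "'a set set \<Rightarrow> 'a set \<Rightarrow> bool" where
  "small U A \<longleftrightarrow> (\<forall>x\<in>A. \<forall>y\<in>A. y \<in> star {x} U)"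

lemma star_singleton_iff: "y \<in> star {x} U \<longleftrightarrow> (\<exists>A\<in>U. x \<in> A \<and> y \<in> A)"
  by (auto simp: star_def)

lemma star_sym: "y \<in> star {x} U \<longleftrightarrow> x \<in> star {y} U"
  by (auto simp: star_singleton_iff)

lemma star_refl: "open_covering X U \<Longrightarrow> x \<in> topspace X \<Longrightarrow> x \<in> star {x} U"
  by (auto simp: star_singleton_iff open_covering_def)

lemma openin_star: "open_covering X U \<Longrightarrow> openin X (star Y U)"
  by (auto simp: star_def open_covering_def)

text \<open>Two members of \<open>V\<close> that share \<open>y\<close> lie in a common member of \<open>U\<close>.\<close>
lemma half_refines_comp:
  assumes "half_refines V U" "y \<in> star {x} V" "z \<in> star {y} V"
  shows "z \<in> star {x} U"
proof -
  obtain A B where "A \<in> V" "B \<in> V" "x \<in> A" "y \<in> A" "y \<in> B" "z \<in> B"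
    using assms(2,3) by (auto simp: star_singleton_iff)
  moreover from this obtain C where "C \<in> U" "A \<union> B \<subseteq> C"
    using assms(1) unfolding half_refines_def by blast
  ultimately show ?thesis by (auto simp: star_singleton_iff)
qed

text \<open>
  Passing to the closure costs three steps \<open>a, t, t', b\<close> with \<open>t, t' \<in> T\<close>, which two successive
  half-refinements absorb.
\<close>
lemma closure_of_small:
  assumes W: "open_covering X W" and WV: "half_refines W V" and VU: "half_refines V U"
    and "small W T"
  shows "small U (X closure_of T)"
  unfolding small_def
proof (intro ballI)
  have near: "\<exists>t\<in>T. t \<in> star {a} W" if "a \<in> X closure_of T" for a
    using that W openin_star[OF W, of "{a}"] star_refl[OF W, of a]
    by (auto simp: in_closure_of)
  fix a b assume a: "a \<in> X closure_of T" and b: "b \<in> X closure_of T"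
  obtain t t' where t: "t \<in> T" "t \<in> star {a} W" "t' \<in> T" "t' \<in> star {b} W"
    using near[OF a] near[OF b] by blast
  have "t' \<in> star {t} W"
    using \<open>small W T\<close> t by (simp add: small_def)
  then have "t' \<in> star {a} V"
    using half_refines_comp[OF WV t(2)] by blast
  moreover have "b \<in> star {t'} V"
    using half_refines_comp[OF WV _ star_refl[OF W]] t(4) b
    by (metis star_sym in_closure_of)
  ultimately show "b \<in> star {a} U"
    by (rule half_refines_comp[OF VU])
qed

lemma cov_diam_iff_small:
  "A \<noteq> {} \<Longrightarrow> U \<in> cov_diam \<O> A \<longleftrightarrow> U \<in> \<O> \<and> small U A"
  by (auto simp: cov_diam_def rho_def small_def)

lemma cov_bounded_iff_small:
  "cov_bounded X \<O> Y \<longleftrightarrow> Y \<noteq> {} \<and> Y \<subseteq> topspace X \<and> (\<exists>U\<in>\<O>. small U Y)"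
  by (auto simp: cov_bounded_def rho_def small_def)

lemma small_imp_in_cov_gamma:
  assumes "U \<in> \<O>" "small U A" "A \<noteq> {}" "A \<subseteq> topspace X"
  shows "U \<in> cov_gamma X \<O> A"
  using assms cov_diam_iff_small[of A U \<O>]
  by (auto simp: cov_gamma_def intro!: exI[of _ "{A}"])


section \<open>The finite intersection property\<close>

definition fip :: "'a set set \<Rightarrow> bool" where
  "fip \<G> \<longleftrightarrow> (\<forall>\<F>. finite \<F> \<and> \<F> \<subseteq> \<G> \<longrightarrow> \<Inter>\<F> \<noteq> {})"

text \<open>
  An extension that is maximal for the finite intersection property is an ultrafilter; the form
  needed here is that a finite cover of a member contains a member. If none of the covering sets
  could be added, each would be disjoint from a finite intersection of members, and together these
  finitely many members would leave nothing of the covered set.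
\<close>
lemma fip_extends_to_prime:
  assumes "fip \<G>"
  obtains \<M> where "\<G> \<subseteq> \<M>" "fip \<M>"
    "\<And>A \<C>. A \<in> \<M> \<Longrightarrow> finite \<C> \<Longrightarrow> A \<subseteq> \<Union>\<C> \<Longrightarrow> \<exists>C\<in>\<C>. C \<in> \<M>"
proof -
  let ?S = "{\<M>. \<G> \<subseteq> \<M> \<and> fip \<M>}"
  have "\<Union>\<K> \<in> ?S" if \<K>: "\<K> \<noteq> {}" "subset.chain ?S \<K>" for \<K>
  proof -
    have "fip (\<Union>\<K>)"
      unfolding fip_def
    proof (intro allI impI, elim conjE)
      fix \<F> assume "finite \<F>" "\<F> \<subseteq> \<Union>\<K>"
      then obtain \<M> where "\<M> \<in> \<K>" "\<F> \<subseteq> \<M>"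
        using finite_subset_Union_chain[of \<F> \<K> ?S] \<K> by blast
      then show "\<Inter>\<F> \<noteq> {}"
        using \<open>finite \<F>\<close> \<K>(2) by (auto simp: subset_chain_def fip_def)
    qed
    moreover obtain \<N> where "\<N> \<in> \<K>" "\<G> \<subseteq> \<N>"
      using \<K> by (auto simp: subset_chain_def)
    ultimately show ?thesis by blast
  qed
  moreover have "?S \<noteq> {}"
    using assms by blast
  ultimately have "\<exists>\<M>\<in>?S. \<forall>\<N>\<in>?S. \<M> \<subseteq> \<N> \<longrightarrow> \<N> = \<M>"
    by (intro subset_Zorn_nonempty)
  then obtain \<M> where \<M>: "\<M> \<in> ?S" and max: "\<And>\<N>. \<N> \<in> ?S \<Longrightarrow> \<M> \<subseteq> \<N> \<Longrightarrow> \<N> = \<M>"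
    by (elim bexE) metis
  have "\<exists>C\<in>\<C>. C \<in> \<M>" if A: "A \<in> \<M>" "finite \<C>" "A \<subseteq> \<Union>\<C>" for A \<C>
  proof (rule ccontr)
    assume none: "\<not> (\<exists>C\<in>\<C>. C \<in> \<M>)"
    have "\<exists>\<F>. finite \<F> \<and> \<F> \<subseteq> \<M> \<and> C \<inter> \<Inter>\<F> = {}" if "C \<in> \<C>" for C
    proof -
      have "\<not> fip (insert C \<M>)"
        using max[of "insert C \<M>"] \<M> none that by blast
      then obtain \<F> where "finite \<F>" "\<F> \<subseteq> insert C \<M>" "\<Inter>\<F> = {}"
        unfolding fip_def by blast
      then show ?thesis
        by (intro exI[of _ "\<F> - {C}"]) auto
    qed
    then obtain \<F> where \<F>:
      "\<And>C. C \<in> \<C> \<Longrightarrow> finite (\<F> C) \<and> \<F> C \<subseteq> \<M> \<and> C \<inter> \<Inter>(\<F> C) = {}"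
      by metis
    have "finite (insert A (\<Union>(\<F> ` \<C>)))" "insert A (\<Union>(\<F> ` \<C>)) \<subseteq> \<M>"
      using A(1,2) \<F> by auto
    then have "\<Inter>(insert A (\<Union>(\<F> ` \<C>))) \<noteq> {}"
      using \<M> unfolding fip_def by blast
    then obtain a where a: "a \<in> A" "\<And>C. C \<in> \<C> \<Longrightarrow> a \<in> \<Inter>(\<F> C)" by blast
    then obtain C where "C \<in> \<C>" "a \<in> C" using A(3) by blast
    then show False
      using a(2) \<F> by blast
  qed
  then show ?thesis
    using that \<M> by blast
qed

lemma prime_fip_Int:
  assumes "fip \<M>" "A \<in> \<M>" "B \<in> \<M>"
    and prime: "\<And>A \<C>. A \<in> \<M> \<Longrightarrow> finite \<C> \<Longrightarrow> A \<subseteq> \<Union>\<C> \<Longrightarrow> \<exists>C\<in>\<C>. C \<in> \<M>"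
  shows "A \<inter> B \<in> \<M>"
proof -
  have "- B \<notin> \<M>"
    using assms(1,3) by (auto simp: fip_def dest!: spec[of _ "{B, - B}"])
  then show ?thesis
    using prime[OF \<open>A \<in> \<M>\<close>, of "{A \<inter> B, - B}"] by auto
qed

text \<open>
  Cantor's intersection theorem for filters: total boundedness is asked only of some member of
  \<open>\<G>\<close> for each \<open>U\<close>, so \<open>\<G>\<close> may contain arbitrary further closed sets. This freedom is what makes
  it yield compactness and not only nonemptiness.
\<close>
lemma complete_fip:
  assumes complete: "cov_complete X \<O>" and "\<O> \<noteq> {}"
    and closed: "\<And>G. G \<in> \<G> \<Longrightarrow> closedin X G" and "fip \<G>"
    and gamma: "\<And>U. U \<in> \<O> \<Longrightarrow> \<exists>G\<in>\<G>. U \<in> cov_gamma X \<O> G"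
  shows "\<Inter>\<G> \<noteq> {}"
proof -
  obtain \<M> where \<M>: "\<G> \<subseteq> \<M>" "fip \<M>"
    and prime: "\<And>A \<C>. A \<in> \<M> \<Longrightarrow> finite \<C> \<Longrightarrow> A \<subseteq> \<Union>\<C> \<Longrightarrow> \<exists>C\<in>\<C>. C \<in> \<M>"
    using fip_extends_to_prime[OF \<open>fip \<G>\<close>] by metis
  have Int: "A \<inter> B \<in> \<M>" if "A \<in> \<M>" "B \<in> \<M>" for A B
    using prime_fip_Int[OF \<M>(2) that prime] .
  have ne: "A \<noteq> {}" if "A \<in> \<M>" for A
    using \<M>(2) that by (auto simp: fip_def dest!: spec[of _ "{A}"])
  have small_member: "\<exists>A\<in>\<M>. A \<subseteq> topspace X \<and> small U A" if U: "U \<in> \<O>" for U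
  proof -
    obtain G \<C> where "G \<in> \<G>" "finite \<C>" "G \<subseteq> \<Union>\<C>"
      and \<C>: "\<forall>A\<in>\<C>. A \<noteq> {} \<and> A \<subseteq> topspace X \<and> U \<in> cov_diam \<O> A"
      using gamma[OF U] unfolding cov_gamma_def by blast
    then obtain A where "A \<in> \<C>" "A \<in> \<M>"
      using prime[of G \<C>] \<M>(1) by blast
    then show ?thesis
      using \<C> cov_diam_iff_small[of A U \<O>] by blast
  qed
  \<comment> \<open>Members of \<open>\<M>\<close>, such as \<open>UNIV\<close>, need not lie in \<open>topspace X\<close>, but the net must.\<close>
  define J :: "'a net_index set" where "J = {(A, a). A \<in> \<M> \<and> A \<subseteq> topspace X \<and> a \<in> A}"
  define le :: "'a net_index \<Rightarrow> 'a net_index \<Rightarrow> bool" where "le p q \<longleftrightarrow> fst q \<subseteq> fst p" for p q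
  have index: "\<exists>p\<in>J. fst p = A" if "A \<in> \<M>" "A \<subseteq> topspace X" for A
    using ne[OF that(1)] that by (auto simp: J_def)
  have "directed_set J le"
    unfolding directed_set_def
  proof (intro conjI ballI)
    show "J \<noteq> {}"
      using \<open>\<O> \<noteq> {}\<close> small_member index by blast
    show "reflp_on J le" by (auto simp: reflp_on_def le_def)
    show "transp_on J le" by (auto simp: transp_on_def le_def)
    fix p q assume "p \<in> J" "q \<in> J"
    then have "fst p \<inter> fst q \<in> \<M>" "fst p \<inter> fst q \<subseteq> topspace X"
      using Int by (auto simp: J_def)
    then obtain r where "r \<in> J" "fst r = fst p \<inter> fst q"
      using index by blast
    then show "\<exists>r\<in>J. le p r \<and> le q r"
      by (auto simp: le_def)
  qed
  moreover have "snd \<in> J \<rightarrow> topspace X"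
    by (auto simp: J_def)
  moreover have "cauchy_net \<O> J le snd"
    unfolding cauchy_net_def
  proof
    fix U assume "U \<in> \<O>"
    then obtain A where A: "A \<in> \<M>" "A \<subseteq> topspace X" "small U A"
      using small_member by blast
    then obtain p where p: "p \<in> J" "fst p = A"
      using index by blast
    have "snd q \<in> A" if "q \<in> J" "le p q" for q
      using that p by (auto simp: J_def le_def)
    then show "\<exists>p\<in>J. \<forall>q\<in>J. \<forall>r\<in>J. le p q \<and> le p r \<longrightarrow> snd q \<in> star {snd r} U"
      using p(1) A(3) unfolding small_def by blast
  qed
  ultimately obtain l where l: "net_converges X J le snd l"
    using complete unfolding cov_complete_def by blast
  have "l \<in> G" if G: "G \<in> \<G>" for G
  proof (rule ccontr)
    assume "l \<notin> G"
    then have "openin X (topspace X - G) \<and> l \<in> topspace X - G"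
      using l closed[OF G] by (auto simp: net_converges_def)
    then obtain p where p: "p \<in> J" "\<And>q. q \<in> J \<Longrightarrow> le p q \<Longrightarrow> snd q \<in> topspace X - G"
      using l unfolding net_converges_def by metis
    \<comment> \<open>The tail of the net at \<open>p\<close> still meets \<open>G\<close>, because \<open>fst p \<inter> G\<close> is a member.\<close>
    have pG: "fst p \<inter> G \<in> \<M>"
      using Int p(1) G \<M>(1) by (auto simp: J_def)
    then obtain a where "a \<in> fst p \<inter> G"
      using ne[OF pG] by blast
    moreover from this have "(fst p \<inter> G, a) \<in> J"
      using pG p(1) by (auto simp: J_def)
    ultimately show False
      using p(2)[of "(fst p \<inter> G, a)"] by (auto simp: le_def)
  qed
  then show ?thesis by blast
qed


section \<open>Completeness and decreasing nets\<close>

lemma admissible_open_covering: "admissible_family X \<O> \<Longrightarrow> U \<in> \<O> \<Longrightarrow> open_covering X U"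
  by (simp add: admissible_family_def)

lemma admissible_half: "admissible_family X \<O> \<Longrightarrow> U \<in> \<O> \<Longrightarrow> \<exists>V\<in>\<O>. half_refines V U"
  by (simp add: admissible_family_def)

lemma admissible_star_subset:
  "admissible_family X \<O> \<Longrightarrow> openin X Y \<Longrightarrow> K \<subseteq> Y \<Longrightarrow> compactin X K \<Longrightarrow> \<exists>U\<in>\<O>. star K U \<subseteq> Y"
  by (simp add: admissible_family_def)

lemma admissible_nonempty: "admissible_family X \<O> \<Longrightarrow> \<O> \<noteq> {}"
  using admissible_star_subset[of X \<O> "{}" "{}"] by auto

text \<open>
  Late points of the net are close to each other and one of them is close to \<open>l\<close>, so all of them
  are close to \<open>l\<close>; the separation condition for the compact set \<open>{l}\<close> turns this into convergence.
\<close>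
lemma cauchy_net_converges_to_cluster_point:
  assumes adm: "admissible_family X \<O>" and cau: "cauchy_net \<O> I le x"
    and cluster: "\<And>i. i \<in> I \<Longrightarrow> l \<in> X closure_of (x ` {j \<in> I. le i j})"
    and "l \<in> topspace X"
  shows "net_converges X I le x l"
  unfolding net_converges_def
proof (intro conjI allI impI)
  show "l \<in> topspace X" by fact
  fix W assume W: "openin X W \<and> l \<in> W"
  then obtain U where U: "U \<in> \<O>" "star {l} U \<subseteq> W"
    using admissible_star_subset[OF adm, of W "{l}"] \<open>l \<in> topspace X\<close> by auto
  obtain V where V: "V \<in> \<O>" "half_refines V U"
    using admissible_half[OF adm U(1)] by blast
  note oc = admissible_open_covering[OF adm V(1)]
  obtain i where i: "i \<in> I"
    "\<And>j k. j \<in> I \<Longrightarrow> k \<in> I \<Longrightarrow> le i j \<Longrightarrow> le i k \<Longrightarrow> x j \<in> star {x k} V"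
    using cau V(1) unfolding cauchy_net_def by blast
  have "\<exists>y\<in>x ` {j \<in> I. le i j}. y \<in> star {l} V"
    using cluster[OF i(1)] openin_star[OF oc, of "{l}"] star_refl[OF oc \<open>l \<in> topspace X\<close>]
    unfolding in_closure_of by metis
  then obtain j where j: "j \<in> I" "le i j" "x j \<in> star {l} V"
    by blast
  have "x k \<in> W" if "k \<in> I" "le i k" for k
    using half_refines_comp[OF V(2) j(3) i(2)[OF that(1) j(1) that(2) j(2)]] U(2) by blast
  then show "\<exists>i\<in>I. \<forall>k\<in>I. le i k \<longrightarrow> x k \<in> W"
    using i(1) by blast
qed

lemma directed_set_refl: "directed_set I le \<Longrightarrow> i \<in> I \<Longrightarrow> le i i"
  by (simp add: directed_set_def reflp_on_def)

lemma directed_set_trans: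
  "directed_set I le \<Longrightarrow> le i j \<Longrightarrow> le j k \<Longrightarrow> i \<in> I \<Longrightarrow> j \<in> I \<Longrightarrow> k \<in> I \<Longrightarrow> le i k"
  using transp_onD[of I le i j k] by (simp add: directed_set_def)

lemma directed_set_upper_bound:
  "directed_set I le \<Longrightarrow> i \<in> I \<Longrightarrow> j \<in> I \<Longrightarrow> \<exists>k\<in>I. le i k \<and> le j k"
  by (simp add: directed_set_def)

lemma directed_tail:
  assumes dir: "directed_set I le" and k: "k \<in> I"
  shows "directed_set {i \<in> I. le k i} le"
proof -
  have "\<exists>c\<in>{i \<in> I. le k i}. le a c \<and> le b c"
    if ab: "a \<in> I" "b \<in> I" "le k a" for a b
  proof -
    obtain c where "c \<in> I" "le a c" "le b c"
      using directed_set_upper_bound[OF dir ab(1,2)] by blast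
    then show ?thesis
      using directed_set_trans[OF dir ab(3)] ab(1) k by blast
  qed
  moreover have "transp_on {i \<in> I. le k i} le"
    using dir by (auto simp: directed_set_def intro: transp_on_subset[of I])
  moreover have "k \<in> {i \<in> I. le k i}" "reflp_on {i \<in> I. le k i} le"
    using directed_set_refl[OF dir] k by (auto simp: reflp_on_def)
  ultimately show ?thesis
    unfolding directed_set_def by blast
qed

lemma decreasing_net_finite_lower_bound:
  assumes dir: "directed_set I le" and dec: "decreasing_net I le F"
    and "finite \<F>" "\<F> \<subseteq> F ` I"
  shows "\<exists>k\<in>I. F k \<subseteq> \<Inter>\<F>"
  using assms(3,4)
proof (induction rule: finite_induct)
  case empty
  then show ?case using dir by (auto simp: directed_set_def)
next
  case (insert A \<F>)
  then obtain i j where ij: "i \<in> I" "F i \<subseteq> \<Inter>\<F>" "j \<in> I" "A = F j" by blast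
  then obtain k where "k \<in> I" "le i k" "le j k"
    using directed_set_upper_bound[OF dir] by blast
  then have "F k \<subseteq> F i" "F k \<subseteq> F j" "k \<in> I"
    using dec ij unfolding decreasing_net_def by blast+
  then show ?case using ij by blast
qed

text \<open>
  The closed sets \<open>\<C>\<close> are the test sets for compactness of the intersection; \<open>\<C> = {}\<close> gives that
  it is nonempty.
\<close>
lemma complete_decreasing_net_meets:
  assumes complete: "cov_complete X \<O>" and "\<O> \<noteq> {}"
    and dir: "directed_set I le" and dec: "decreasing_net I le F"
    and closed: "\<And>i. i \<in> I \<Longrightarrow> closedin X (F i)"
    and gamma: "converges_to_family \<O> I le (\<lambda>i. cov_gamma X \<O> (F i))"
    and \<C>: "\<And>C. C \<in> \<C> \<Longrightarrow> closedin X C"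
    and meets: "\<And>i \<F>. i \<in> I \<Longrightarrow> finite \<F> \<Longrightarrow> \<F> \<subseteq> \<C> \<Longrightarrow> F i \<inter> \<Inter>\<F> \<noteq> {}"
  shows "(\<Inter>i\<in>I. F i) \<inter> \<Inter>\<C> \<noteq> {}"
proof -
  have "\<Inter>(F ` I \<union> \<C>) \<noteq> {}"
  proof (rule complete_fip[OF complete \<open>\<O> \<noteq> {}\<close>])
    show "closedin X G" if "G \<in> F ` I \<union> \<C>" for G
      using that closed \<C> by blast
    show "\<exists>G\<in>F ` I \<union> \<C>. U \<in> cov_gamma X \<O> G" if "U \<in> \<O>" for U
    proof -
      obtain i where "i \<in> I" "\<forall>j\<in>I. le i j \<longrightarrow> U \<in> cov_gamma X \<O> (F j)"
        using gamma \<open>U \<in> \<O>\<close> unfolding converges_to_family_def by blast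
      moreover from this have "le i i"
        using directed_set_refl[OF dir] by blast
      ultimately show ?thesis by blast
    qed
    show "fip (F ` I \<union> \<C>)"
      unfolding fip_def
    proof (intro allI impI, elim conjE)
      fix \<F> assume \<F>: "finite \<F>" "\<F> \<subseteq> F ` I \<union> \<C>"
      obtain k where "k \<in> I" "F k \<subseteq> \<Inter>(\<F> \<inter> F ` I)"
        using decreasing_net_finite_lower_bound[OF dir dec, of "\<F> \<inter> F ` I"] \<F>(1) by blast
      moreover have "F k \<inter> \<Inter>(\<F> \<inter> \<C>) \<noteq> {}"
        using meets[of k "\<F> \<inter> \<C>"] \<F>(1) \<open>k \<in> I\<close> by blast
      ultimately show "\<Inter>\<F> \<noteq> {}"
        using \<F>(2) by blast
    qed
  qed
  then show ?thesis by (simp add: Inf_union_distrib)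
qed

lemma complete_imp_intersection_compact:
  assumes complete: "cov_complete X \<O>" and "\<O> \<noteq> {}"
    and dir: "directed_set I le" and dec: "decreasing_net I le F"
    and F: "\<And>i. i \<in> I \<Longrightarrow> F i \<noteq> {} \<and> closedin X (F i)"
    and gamma: "converges_to_family \<O> I le (\<lambda>i. cov_gamma X \<O> (F i))"
  shows "(\<Inter>i\<in>I. F i) \<noteq> {} \<and> compactin X (\<Inter>i\<in>I. F i)"
proof
  note meets = complete_decreasing_net_meets[OF complete \<open>\<O> \<noteq> {}\<close> dir dec _ gamma]
  show "(\<Inter>i\<in>I. F i) \<noteq> {}"
    using meets[of "{}"] F by simp
  have "(\<Inter>i\<in>I. F i) \<subseteq> topspace X"
    using dir F closedin_subset unfolding directed_set_def by blast
  moreover have "(\<Inter>i\<in>I. F i) \<inter> \<Inter>\<C> \<noteq> {}"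
    if closed: "\<forall>C\<in>\<C>. closedin X C"
      and fip: "\<forall>\<F>. finite \<F> \<and> \<F> \<subseteq> \<C> \<longrightarrow> (\<Inter>i\<in>I. F i) \<inter> \<Inter>\<F> \<noteq> {}" for \<C>
  proof (rule meets)
    show "F i \<inter> \<Inter>\<F> \<noteq> {}" if "i \<in> I" "finite \<F>" "\<F> \<subseteq> \<C>" for i \<F>
    proof -
      have "(\<Inter>i\<in>I. F i) \<inter> \<Inter>\<F> \<noteq> {}"
        using fip that(2,3) by simp
      then show ?thesis
        using that(1) by auto
    qed
  qed (use F closed in auto)
  ultimately show "compactin X (\<Inter>i\<in>I. F i)"
    unfolding compactin_fip by simp
qed

lemma cauchy_net_small_tail:
  assumes "cauchy_net \<O> I le x" "U \<in> \<O>"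
  obtains i where "i \<in> I" "small U (x ` {j \<in> I. le i j})"
proof -
  obtain i where "i \<in> I" "\<forall>j\<in>I. \<forall>k\<in>I. le i j \<and> le i k \<longrightarrow> x j \<in> star {x k} U"
    using assms unfolding cauchy_net_def by blast
  then show ?thesis
    using that by (auto simp: small_def)
qed

lemma cauchy_net_small_tail_closure:
  assumes adm: "admissible_family X \<O>" and "cauchy_net \<O> I le x" "U \<in> \<O>"
  obtains i where "i \<in> I" "small U (X closure_of (x ` {j \<in> I. le i j}))"
proof -
  obtain V W where "W \<in> \<O>" "half_refines W V" "half_refines V U"
    using admissible_half[OF adm] \<open>U \<in> \<O>\<close> by meson
  then show ?thesis
    using cauchy_net_small_tail[OF assms(2)] closure_of_small admissible_open_covering[OF adm] that
    by metis
qed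

theorem theorem3:
  fixes X :: "'a topology" and \<O> :: "'a set set set"
  assumes "admissible_family X \<O>"
  shows "cov_complete X \<O> \<longleftrightarrow>
    (\<forall>(I :: 'a net_index set) le F.
       directed_set I le \<and> decreasing_net I le F \<and>
       (\<forall>i\<in>I. F i \<noteq> {} \<and> cov_bounded X \<O> (F i) \<and> closedin X (F i)) \<and>
       converges_to_family \<O> I le (\<lambda>i. cov_gamma X \<O> (F i))
       \<longrightarrow> (\<Inter>i\<in>I. F i) \<noteq> {} \<and> compactin X (\<Inter>i\<in>I. F i))"
    (is "_ \<longleftrightarrow> ?cantor")
proof
  assume "cov_complete X \<O>"
  then show ?cantor
    using complete_imp_intersection_compact[OF _ admissible_nonempty[OF assms]] by blast
next
  assume cantor: ?cantor
  show "cov_complete X \<O>"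
    unfolding cov_complete_def
  proof (intro allI impI, elim conjE)
    fix I :: "'a net_index set" and le x
    assume dir: "directed_set I le" and x: "x \<in> I \<rightarrow> topspace X" and cau: "cauchy_net \<O> I le x"
    define F where "F i = X closure_of (x ` {j \<in> I. le i j})" for i
    note refl = directed_set_refl[OF dir] and trans = directed_set_trans[OF dir]
    have anti: "F j \<subseteq> F i" if "i \<in> I" "j \<in> I" "le i j" for i j
      unfolding F_def using that trans by (intro closure_of_mono) blast
    have xF: "x i \<in> F i" if "i \<in> I" for i
      using that x refl closure_of_subset[of "x ` {j \<in> I. le i j}" X] by (fastforce simp: F_def)
    have FX: "F i \<subseteq> topspace X" for i
      by (simp add: F_def closure_of_subset_topspace)
    \<comment> \<open>Only the late tails are bounded, so the net \<open>F\<close> is restricted to the indices after \<open>k\<close>.\<close>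
    obtain U\<^sub>0 k where k: "U\<^sub>0 \<in> \<O>" "k \<in> I" "small U\<^sub>0 (F k)"
      using cauchy_net_small_tail_closure[OF assms cau] admissible_nonempty[OF assms]
      unfolding F_def by (metis ex_in_conv)
    let ?J = "{i \<in> I. le k i}"
    have dirJ: "directed_set ?J le"
      using directed_tail[OF dir k(2)] .
    have "decreasing_net ?J le F"
      using anti by (auto simp: decreasing_net_def)
    moreover have "F i \<noteq> {} \<and> cov_bounded X \<O> (F i) \<and> closedin X (F i)" if i: "i \<in> ?J" for i
    proof -
      have "small U\<^sub>0 (F i)"
        using k(3) anti[of k i] k(2) i unfolding small_def by blast
      then show ?thesis
        using xF[of i] i k(1) FX by (auto simp: cov_bounded_iff_small F_def)
    qed
    moreover have "converges_to_family \<O> ?J le (\<lambda>i. cov_gamma X \<O> (F i))"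
      unfolding converges_to_family_def
    proof
      fix U assume U: "U \<in> \<O>"
      obtain i where i: "i \<in> I" "small U (F i)"
        using cauchy_net_small_tail_closure[OF assms cau U] unfolding F_def by metis
      obtain j where j: "j \<in> I" "le i j" "le k j"
        using directed_set_upper_bound[OF dir i(1) k(2)] by blast
      have "U \<in> cov_gamma X \<O> (F n)" if n: "n \<in> I" "le j n" for n
      proof (rule small_imp_in_cov_gamma[OF U])
        have "F n \<subseteq> F i"
          using anti[of i n] trans[OF j(2) n(2)] i(1) j(1) n(1) by blast
        then show "small U (F n)"
          using i(2) unfolding small_def by blast
      qed (use xF[OF n(1)] FX in auto)
      then show "\<exists>j\<in>?J. \<forall>n\<in>?J. le j n \<longrightarrow> U \<in> cov_gamma X \<O> (F n)"
        using j by blast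
    qed
    ultimately have "(\<Inter>i\<in>?J. F i) \<noteq> {}"
      using cantor dirJ by blast
    then obtain l where l: "\<And>i. i \<in> ?J \<Longrightarrow> l \<in> F i" by blast
    have "l \<in> F i" if i: "i \<in> I" for i
    proof -
      obtain j where "j \<in> I" "le i j" "le k j"
        using directed_set_upper_bound[OF dir i k(2)] by blast
      then show ?thesis
        using anti[of i j] i l[of j] by blast
    qed
    moreover have "l \<in> topspace X"
      using l[of k] k(2) refl FX by blast
    ultimately have "net_converges X I le x l"
      using cauchy_net_converges_to_cluster_point[OF assms cau] unfolding F_def by blast
    then show "\<exists>l. net_converges X I le x l" by blast
  qed
qed

end
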